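(* Let $A$ be a finite set with a distinguished element $0$, let $(B;+)$ be a finite Boolean group, let $n \ge 1$ and $t \ge 1$ be integers with $n - |A| = 2t > 0$, and let $f \colon A^n \to B$. Then $f$ is determined by $\operatorname{oddsupp}$ if and only if there is a map $\varphi \colon \mathcal{P}(A) \to B$ satisfying $\varphi(S) = \varphi(S \triangle \{0\})$ for every $S \subseteq A$ such that for all $\mathbf{x} \in A^n$ \[ f(\mathbf{x}) = \sum_{i = t + 1}^{\lfloor n/2 \rfloor} \sum_{\substack{I \subseteq [n] \\ |I| = n - 2i}} \binom{i - 1}{t} \varphi(\operatorname{oddsupp}(\mathbf{x}|_I)) + \sum_{k = t + 1}^{\lfloor (n+1)/2 \rfloor} \sum_{\substack{K \subseteq [n] \\ |K| = n - 2k + 1}} \binom{2k - 1}{2t} \varphi(\operatorname{oddsupp}(\mathbf{x}|_K)). \] Moreover, such a $\varphi$ is uniquely determined by $f$.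
   Context: A Boolean group is an abelian group in which $b + b = 0$ for all $b$; an integer coefficient $m$ times an element $b$ means $b + \dots + b$ ($m$ times). $\triangle$ denotes symmetric difference of sets. $[n] = \{1,\dots,n\}$. For $\mathbf{x} \in A^n$ and $I = \{i_1 < \dots < i_k\} \subseteq [n]$, $\mathbf{x}|_I = (x_{i_1}, \dots, x_{i_k})$ (the empty tuple if $I = \emptyset$). For a tuple $(a_1,\dots,a_m)$ over $A$ ($m \ge 0$), $\operatorname{oddsupp}(a_1,\dots,a_m) = \{a \in A : |\{j : a_j = a\}| \text{ is odd}\}$ (so $\operatorname{oddsupp}$ of the empty tuple is $\emptyset$). A function $f \colon A^n \to B$ is determined by $\operatorname{oddsupp}$ if there is a map $\psi \colon \mathcal{P}(A) \to B$ with $f(\mathbf{x}) = \psi(\operatorname{oddsupp}(\mathbf{x}))$ for all $\mathbf{x} \in A^n$. *)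

theory Defs
  imports "HOL-Library.Cardinality"
begin

(* Conventions.  The finite set A is the universe of a type 'a :: finite.  An n-tuple over A is a
   list of length n, so a function on n-tuples is a function f :: 'a list => 'b of which only the
   values on lists of length n matter.  Positions are numbered from 0, i.e. [n] is {..<n}, and the
   restriction of a tuple x to a set I of positions is the library's nths x I. *)

definition oddsupp :: "'a list \<Rightarrow> 'a set" where
  "oddsupp xs = {a. odd (count_list xs a)}"

definition determined_by_oddsupp :: "nat \<Rightarrow> ('a list \<Rightarrow> 'b) \<Rightarrow> bool" where
  "determined_by_oddsupp n f \<longleftrightarrow>
     (\<exists>\<psi> :: 'a set \<Rightarrow> 'b. \<forall>xs. length xs = n \<longrightarrow> f xs = \<psi> (oddsupp xs))"

definition nmult :: "nat \<Rightarrow> 'b::comm_monoid_add \<Rightarrow> 'b" where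
  "nmult m b = (\<Sum>_<m. b)"

(* n + 1 - 2 * k is n - 2k + 1: written in this order the natural subtraction never truncates,
   as 2k <= n + 1 on the summation range. *)

definition oddsupp_formula ::
    "nat \<Rightarrow> nat \<Rightarrow> ('a set \<Rightarrow> 'b::comm_monoid_add) \<Rightarrow> 'a list \<Rightarrow> 'b" where
  "oddsupp_formula n t \<phi> xs =
     (\<Sum>i = t + 1..n div 2. \<Sum>I | I \<subseteq> {..<n} \<and> card I = n - 2 * i.
        nmult ((i - 1) choose t) (\<phi> (oddsupp (nths xs I)))) +
     (\<Sum>k = t + 1..(n + 1) div 2. \<Sum>K | K \<subseteq> {..<n} \<and> card K = n + 1 - 2 * k.
        nmult ((2 * k - 1) choose (2 * t)) (\<phi> (oddsupp (nths xs K))))"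

definition represents ::
    "'a \<Rightarrow> nat \<Rightarrow> nat \<Rightarrow> ('a list \<Rightarrow> 'b) \<Rightarrow> ('a set \<Rightarrow> 'b::comm_monoid_add) \<Rightarrow> bool" where
  "represents z n t f \<phi> \<longleftrightarrow>
     (\<forall>S. \<phi> S = \<phi> (sym_diff S {z})) \<and>
     (\<forall>xs. length xs = n \<longrightarrow> f xs = oddsupp_formula n t \<phi> xs)"

end

theory Submission
  imports Defs
begin

text \<open>
  Modulo 2 both families of coefficients agree, and the formula is the sum of
  \<open>\<phi> (oddsupp (nths xs I))\<close> over all \<open>I\<close> whose codegree \<open>j = n - card I > 0\<close> satisfies that
  \<open>(j - 1) div 2 choose t\<close> is odd. If two entries of \<open>xs\<close> are equal, the sets \<open>I\<close> containing
  exactly one of the two positions cancel in pairs, so both entries can be deleted at the price of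
  replacing the weight \<open>w j\<close> by \<open>w j + w (j + 2)\<close>; by Pascal's rule this lowers \<open>t\<close> by one. As
  \<open>n = CARD('a) + 2 * t\<close>, there are always \<open>t\<close> such deletions. If the remaining entries exhaust
  the type, the sum is \<open>\<phi>\<close> over all proper subsets, which is \<open>\<phi> UNIV\<close> because \<open>S\<close> and
  \<open>sym_diff S {z}\<close> cancel; otherwise one more deletion leaves only the full index set.
  Either way the formula collapses to \<open>\<phi> (oddsupp xs)\<close>.
\<close>

section \<open>Odd supports of tuples and the parity of their size\<close>

lemma oddsupp_Nil [simp]: "oddsupp [] = {}"
  by (simp add: oddsupp_def)

lemma oddsupp_Cons: "oddsupp (x # xs) = sym_diff (oddsupp xs) {x}"
  by (auto simp: oddsupp_def)

lemma oddsupp_append: "oddsupp (xs @ ys) = sym_diff (oddsupp xs) (oddsupp ys)"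
  by (auto simp: oddsupp_def)

lemma oddsupp_replicate_even:
  assumes "even m"
  shows "oddsupp (replicate m a) = {}"
proof -
  have "count_list (replicate m a) b = (if a = b then m else 0)" for b
    by (induction m) auto
  with assms show ?thesis
    by (simp add: oddsupp_def)
qed

lemma oddsupp_distinct:
  assumes "distinct xs"
  shows "oddsupp xs = set xs"
  using assms by (induction xs) (auto simp: oddsupp_Cons)

lemma finite_oddsupp [simp]: "finite (oddsupp xs)"
  by (induction xs) (auto simp: oddsupp_Cons)

lemma even_card_sym_diff_singleton:
  assumes "finite S"
  shows "even (card (sym_diff S {x})) \<longleftrightarrow> odd (card S)"
proof (cases "x \<in> S")
  case True
  then have "sym_diff S {x} = S - {x}" "card S = Suc (card (S - {x}))"
    using assms card.remove[of S x] by auto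
  then show ?thesis by simp
next
  case False
  then have "sym_diff S {x} = insert x S" by auto
  with False assms show ?thesis by simp
qed

lemma even_card_oddsupp: "even (card (oddsupp xs)) \<longleftrightarrow> even (length xs)"
  by (induction xs) (simp_all add: oddsupp_Cons even_card_sym_diff_singleton del: Un_iff)

text \<open>List \<open>S\<close> without repetition and pad with an even number of copies of one
  arbitrary element; the padding leaves the odd support unchanged.\<close>

lemma obtain_list_oddsupp:
  fixes S :: "'a::finite set"
  assumes "card S \<le> n" "even (card S) \<longleftrightarrow> even n"
  obtains xs where "length xs = n" "oddsupp xs = S"
proof -
  obtain ys where ys: "set ys = S" "distinct ys"
    using finite_distinct_list[of S] by auto
  let ?xs = "ys @ replicate (n - card S) undefined"
  have "length ?xs = n"
    using ys assms by (auto simp: distinct_card)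
  moreover have "oddsupp ?xs = S"
    using ys assms by (simp add: oddsupp_append oddsupp_replicate_even oddsupp_distinct)
  ultimately show thesis
    using that by blast
qed

section \<open>Binomial coefficients modulo 2 and the weight of a codegree\<close>

lemma odd_binomial_double:
  "even ((2 * m) choose (2 * t + 1))" "odd ((2 * m) choose (2 * t)) \<longleftrightarrow> odd (m choose t)"
proof (induction m arbitrary: t)
  case 0
  {
    case 1 show ?case by simp
  next
    case 2 show ?case by (cases t) auto
  }
next
  case (Suc m)
  {
    \<comment> \<open>Pascal's rule is applied twice: the middle term occurs twice and vanishes
      modulo 2, and the outer terms are covered by the induction hypotheses at \<open>t\<close> and
      \<open>t - 1\<close>.\<close>
    case 1 show ?case using Suc[of t] Suc[of "t - 1"] by (cases t) auto
  next
    case 2 show ?case using Suc[of t] Suc[of "t - 1"] by (cases t) auto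
  }
qed

lemma odd_binomial_double_Suc: "odd ((2 * m + 1) choose (2 * t)) \<longleftrightarrow> odd (m choose t)"
  using odd_binomial_double(2)[of m t] odd_binomial_double(1)[of m "t - 1"] by (cases t) auto

text \<open>For \<open>j = 2 * i\<close> the binomial is \<open>(i - 1) choose t\<close>; for
  \<open>j = 2 * k - 1\<close> it is \<open>(k - 1) choose t\<close>, which has the parity of
  \<open>(2 * k - 1) choose (2 * t)\<close>. So one predicate serves both sums. The guard
  \<open>0 < j\<close> excludes the full index set at \<open>t = 0\<close>, where truncated
  subtraction would give \<open>0 choose 0\<close>.\<close>

definition weight :: "nat \<Rightarrow> nat \<Rightarrow> bool" where
  "weight t j \<longleftrightarrow> 0 < j \<and> odd (((j - 1) div 2) choose t)"

lemma weight_0: "weight 0 j \<longleftrightarrow> 0 < j"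
  by (simp add: weight_def)

lemma weight_Suc: "(weight (Suc t) j \<noteq> weight (Suc t) (j + 2)) = weight t j"
proof (cases j)
  case (Suc i)
  then have "(j + 2 - 1) div 2 = Suc (i div 2)" by simp
  with Suc show ?thesis by (auto simp: weight_def)
qed (simp add: weight_def)

section \<open>Weighted sums over index sets\<close>

definition wsum :: "(nat \<Rightarrow> bool) \<Rightarrow> ('a set \<Rightarrow> 'b::comm_monoid_add) \<Rightarrow> 'a list \<Rightarrow> 'b" where
  "wsum w g xs = (\<Sum>I\<in>Pow {..<length xs}.
     if w (length xs - card I) then g (oddsupp (nths xs I)) else 0)"

lemma Pow_lessThan_Suc:
  "Pow {..<Suc n} = (\<lambda>I. insert 0 (Suc ` I)) ` Pow {..<n} \<union> (`) Suc ` Pow {..<n}"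
proof -
  have "Pow {..<Suc n} = Pow (insert 0 (Suc ` {..<n}))"
    by (simp add: lessThan_Suc_eq_insert_0)
  also have "\<dots> = Pow (Suc ` {..<n}) \<union> insert 0 ` Pow (Suc ` {..<n})"
    by (rule Pow_insert)
  finally show ?thesis
    by (auto simp: image_Pow_surj[OF refl, symmetric] image_image)
qed

lemma wsum_Nil: "wsum w g [] = (if w 0 then g {} else 0)"
  by (simp add: wsum_def)

text \<open>Split by whether position 0 is kept: keeping it toggles \<open>x\<close> in the odd
  support and preserves the codegree, dropping it raises the codegree by one. Indexing weights by
  codegree rather than size makes this recursion uniform.\<close>

lemma wsum_Cons:
  "wsum w g (x # xs) = wsum w (\<lambda>S. g (sym_diff S {x})) xs + wsum (\<lambda>j. w (Suc j)) g xs"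
proof -
  let ?n = "length xs"
  let ?h = "\<lambda>I. if w (Suc ?n - card I) then g (oddsupp (nths (x # xs) I)) else 0"
  have inj: "inj_on (\<lambda>I. insert 0 (Suc ` I)) (Pow {..<?n})" "inj_on ((`) Suc) (Pow {..<?n})"
    by (auto simp: inj_on_def)
  have "wsum w g (x # xs) = sum ?h (Pow {..<Suc ?n})"
    by (simp add: wsum_def)
  also have "\<dots> = sum ?h ((\<lambda>I. insert 0 (Suc ` I)) ` Pow {..<?n}) + sum ?h ((`) Suc ` Pow {..<?n})"
    unfolding Pow_lessThan_Suc by (intro sum.union_disjoint) auto
  also have "sum ?h ((\<lambda>I. insert 0 (Suc ` I)) ` Pow {..<?n})
      = wsum w (\<lambda>S. g (sym_diff S {x})) xs"
    unfolding sum.reindex[OF inj(1)] wsum_def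
  proof (intro sum.cong refl, unfold o_def)
    fix I assume "I \<in> Pow {..<?n}"
    then have "finite I" using finite_subset by blast
    then have "card (insert 0 (Suc ` I)) = Suc (card I)"
      by (simp add: card_image)
    then show "?h (insert 0 (Suc ` I)) =
        (if w (?n - card I) then g (sym_diff (oddsupp (nths xs I)) {x}) else 0)"
      by (simp add: nths_Cons oddsupp_Cons image_iff)
  qed
  also have "sum ?h ((`) Suc ` Pow {..<?n}) = wsum (\<lambda>j. w (Suc j)) g xs"
    unfolding sum.reindex[OF inj(2)] wsum_def
  proof (intro sum.cong refl, unfold o_def)
    fix I assume "I \<in> Pow {..<?n}"
    \<comment> \<open>This bound ensures that \<open>Suc ?n - card I\<close> is
      \<open>Suc (?n - card I)\<close>.\<close>
    then have "card I \<le> ?n" using card_mono[of "{..<?n}" I] by auto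
    then show "?h (Suc ` I) = (if w (Suc (?n - card I)) then g (oddsupp (nths xs I)) else 0)"
      by (simp add: nths_Cons image_iff card_image Suc_diff_le)
  qed
  finally show ?thesis .
qed

text \<open>Toggles of different entries commute, so the sum does not depend on the order of the
  tuple.\<close>

lemma wsum_middle: "wsum w g (us @ y # vs) = wsum w g (y # us @ vs)"
proof (induction us arbitrary: w g)
  case (Cons u us)
  have *: "sym_diff (sym_diff S {u}) {y} = sym_diff (sym_diff S {y}) {u}" for S
    by blast
  show ?case
    by (simp add: wsum_Cons[of _ _ u] wsum_Cons[of _ _ y] Cons * add_ac)
qed simp

lemma wsum_zero_codegree: "wsum (\<lambda>j. j = 0) g xs = g (oddsupp xs)"
proof -
  have "length xs - card I = 0 \<longleftrightarrow> I = {..<length xs}" if "I \<in> Pow {..<length xs}" for I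
    using that card_seteq[of "{..<length xs}" I] by auto
  then have "wsum (\<lambda>j. j = 0) g xs = (\<Sum>I\<in>Pow {..<length xs}.
      if I = {..<length xs} then g (oddsupp (nths xs I)) else 0)"
    unfolding wsum_def by (intro sum.cong) auto
  also have "\<dots> = g (oddsupp xs)"
    by (subst sum.delta) (auto simp: nths_all)
  finally show ?thesis .
qed

text \<open>Without repetitions, index sets correspond to subsets of \<open>set xs\<close>, each
  being its own odd support.\<close>

lemma wsum_distinct:
  assumes "distinct xs"
  shows "wsum w g xs = (\<Sum>S\<in>Pow (set xs). if w (length xs - card S) then g S else 0)"
  using assms
proof (induction xs arbitrary: w g)
  case (Cons x xs)
  let ?h = "\<lambda>S. if w (Suc (length xs) - card S) then g S else 0"
  have inj: "inj_on (insert x) (Pow (set xs))"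
    using Cons.prems by (auto simp: inj_on_def)
  have len: "length xs = card (set xs)"
    using Cons.prems by (simp add: distinct_card)
  have "sum ?h (Pow (set (x # xs))) = sum ?h (Pow (set xs)) + sum ?h (insert x ` Pow (set xs))"
    unfolding list.set Pow_insert using Cons.prems by (intro sum.union_disjoint) auto
  also have "sum ?h (insert x ` Pow (set xs)) = wsum w (\<lambda>S. g (sym_diff S {x})) xs"
    unfolding sum.reindex[OF inj] o_def
  proof (subst Cons.IH, use Cons.prems in simp, intro sum.cong refl)
    fix S assume S: "S \<in> Pow (set xs)"
    then have "x \<notin> S" "finite S" using Cons.prems finite_subset by auto
    moreover from this have "sym_diff S {x} = insert x S" by auto
    ultimately show "?h (insert x S) = (if w (length xs - card S) then g (sym_diff S {x}) else 0)"
      by simp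
  qed
  also have "sum ?h (Pow (set xs)) = wsum (\<lambda>j. w (Suc j)) g xs"
  proof (subst Cons.IH, use Cons.prems in simp, intro sum.cong refl)
    fix S assume "S \<in> Pow (set xs)"
    then have "card S \<le> length xs" unfolding len by (auto intro: card_mono)
    then show "?h S = (if w (Suc (length xs - card S)) then g S else 0)"
      by (simp add: Suc_diff_le)
  qed
  finally show ?case
    by (simp add: wsum_Cons ac_simps)
qed (simp add: wsum_Nil)

section \<open>Cancellation in a Boolean group\<close>

context
  assumes boolean: "\<And>b :: 'b::ab_group_add. b + b = 0"
begin

lemma nmult_boolean: "nmult m (b :: 'b) = (if odd m then b else 0)"
proof (induction m)
  case (Suc m)
  have "nmult (Suc m) b = nmult m b + b"
    by (simp add: nmult_def)
  with Suc boolean show ?case by simp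
qed (simp add: nmult_def)

lemma wsum_add:
  fixes g :: "'a set \<Rightarrow> 'b"
  shows "wsum v g xs + wsum w g xs = wsum (\<lambda>j. v j \<noteq> w j) g xs"
  unfolding wsum_def sum.distrib[symmetric] by (intro sum.cong) (auto simp: boolean)

text \<open>Keeping both copies toggles \<open>y\<close> twice, which has no effect; the two ways of
  keeping exactly one give equal sums that cancel; dropping both shifts the codegree by 2.\<close>

lemma wsum_pair:
  fixes g :: "'a set \<Rightarrow> 'b"
  shows "wsum w g (y # y # xs) = wsum (\<lambda>j. w j \<noteq> w (j + 2)) g xs"
proof -
  have "sym_diff (sym_diff S {y}) {y} = S" for S
    by blast
  then have "wsum w g (y # y # xs) = wsum w g xs + (wsum (\<lambda>j. w (Suc j)) (\<lambda>S. g (sym_diff S {y})) xs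
      + wsum (\<lambda>j. w (Suc j)) (\<lambda>S. g (sym_diff S {y})) xs) + wsum (\<lambda>j. w (j + 2)) g xs"
    by (simp add: wsum_Cons[of _ _ y] ac_simps)
  then show ?thesis
    unfolding boolean by (simp add: wsum_add)
qed

lemma not_distinct_remove_pair:
  assumes "\<not> distinct xs"
  obtains ys where "length xs = length ys + 2" "oddsupp xs = oddsupp ys"
    "\<And>w g :: 'a set \<Rightarrow> 'b. wsum w g xs = wsum (\<lambda>j. w j \<noteq> w (j + 2)) g ys"
proof -
  obtain us y vs ws where xs: "xs = us @ [y] @ vs @ [y] @ ws"
    using assms not_distinct_decomp by blast
  let ?ys = "us @ vs @ ws"
  have "wsum w g xs = wsum (\<lambda>j. w j \<noteq> w (j + 2)) g ?ys" for w and g :: "'a set \<Rightarrow> 'b"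
  proof -
    have "wsum w g xs = wsum w g (y # (us @ vs) @ y # ws)"
      using wsum_middle[of w g us y] by (simp add: xs)
    also have "\<dots> = wsum w g (y # y # ?ys)"
      \<comment> \<open>The first \<open>y\<close> is peeled off so that the second can be moved to
        the front of the remaining tuple in both resulting sums.\<close>
      unfolding wsum_Cons[of _ _ y "(us @ vs) @ y # ws"] wsum_Cons[of _ _ y "y # ?ys"] wsum_middle
      by simp
    finally show ?thesis
      by (simp add: wsum_pair)
  qed
  moreover have "oddsupp xs = oddsupp ?ys"
    by (auto simp: xs oddsupp_def)
  ultimately show thesis
    by (intro that[of ?ys]) (auto simp: xs)
qed

text \<open>Toggling \<open>z\<close> is a bijection between the sets with and without
  \<open>z\<close> that preserves \<open>g\<close>, so the total is twice one half.\<close>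

lemma sum_UNIV_eq_0:
  fixes g :: "'a::finite set \<Rightarrow> 'b"
  assumes "\<And>S. g S = g (sym_diff S {z})"
  shows "sum g UNIV = 0"
proof -
  have "sum g UNIV = sum g {S. z \<in> S} + sum g {S. z \<notin> S}"
    by (subst sum.union_disjoint[symmetric]) (auto intro: arg_cong[of _ _ "sum g"])
  also have "sum g {S. z \<in> S} = (\<Sum>S | z \<in> S. g (sym_diff S {z}))"
    by (rule sum.cong[OF refl assms])
  also have "\<dots> = sum g {S. z \<notin> S}"
    by (intro sum.reindex_bij_witness[of _ "\<lambda>S. sym_diff S {z}" "\<lambda>S. sym_diff S {z}"]) auto
  finally show ?thesis
    using boolean by simp
qed

lemma wsum_weight:
  fixes g :: "'a::finite set \<Rightarrow> 'b"
  assumes g: "\<And>S. g S = g (sym_diff S {z})"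
    and "length xs = CARD('a) + 2 * t"
  shows "wsum (weight t) g xs = g (oddsupp xs)"
  using assms(2)
proof (induction t arbitrary: xs)
  case 0
  show ?case
  proof (cases "distinct xs")
    case True
    then have set_xs: "set xs = UNIV"
      using 0 by (intro card_subset_eq) (auto simp: distinct_card)
    have "0 < CARD('a) - card S \<longleftrightarrow> S \<noteq> UNIV" for S :: "'a set"
      using card_seteq[of UNIV S] by fastforce
    then have "wsum (weight 0) g xs = (\<Sum>S\<in>UNIV. if S \<noteq> UNIV then g S else 0)"
      unfolding wsum_distinct[OF True] using 0
      by (intro sum.cong) (auto simp: set_xs weight_0)
    \<comment> \<open>Zero is added as \<open>g UNIV + g UNIV\<close>: one copy completes the sum to
      all subsets, which vanishes, and the other is the result.\<close>
    also have "\<dots> = (\<Sum>S\<in>UNIV. if S \<noteq> UNIV then g S else 0) + (g UNIV + g UNIV)"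
      by (simp add: boolean)
    also have "\<dots> = (\<Sum>S\<in>UNIV. (if S \<noteq> UNIV then g S else 0) + (if S = UNIV then g S else 0)) + g UNIV"
      unfolding sum.distrib by (simp add: add.assoc)
    also have "\<dots> = sum g UNIV + g UNIV"
      by (intro arg_cong2[of _ _ _ _ "(+)"] sum.cong) auto
    finally show ?thesis
      using True by (simp add: sum_UNIV_eq_0[of g z, OF g] set_xs oddsupp_distinct)
  next
    case False
    then obtain ys where "oddsupp xs = oddsupp ys"
      "wsum (weight 0) g xs = wsum (\<lambda>j. weight 0 j \<noteq> weight 0 (j + 2)) g ys"
      using not_distinct_remove_pair by metis
    \<comment> \<open>\<open>weight 0 (j + 2)\<close> always holds and \<open>weight 0 j\<close>
      fails only at 0, so only the full index set survives.\<close>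
    moreover have "(\<lambda>j. weight 0 j \<noteq> weight 0 (j + 2)) = (\<lambda>j. j = 0)"
      by (auto simp: weight_0)
    ultimately show ?thesis
      by (simp add: wsum_zero_codegree)
  qed
next
  case (Suc t)
  have "\<not> distinct xs"
  proof
    assume "distinct xs"
    then have "length xs \<le> CARD('a)"
      using card_mono[of UNIV "set xs"] by (simp add: distinct_card)
    with Suc.prems show False by simp
  qed
  then obtain ys where "length xs = length ys + 2" "oddsupp xs = oddsupp ys"
    "wsum (weight (Suc t)) g xs = wsum (\<lambda>j. weight (Suc t) j \<noteq> weight (Suc t) (j + 2)) g ys"
    using not_distinct_remove_pair by metis
  with Suc show ?case
    by (simp only: weight_Suc) simp
qed

section \<open>Identifying the formula with a weighted sum\<close>

lemma weight_coefficients: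
  fixes b :: 'b
  assumes "c \<le> n" "t \<ge> 1"
  shows "(\<Sum>i = t + 1..n div 2. if c = n - 2 * i then nmult ((i - 1) choose t) b else 0) +
    (\<Sum>k = t + 1..(n + 1) div 2.
      if c = n + 1 - 2 * k then nmult ((2 * k - 1) choose (2 * t)) b else 0) =
    (if weight t (n - c) then b else 0)" (is "?E + ?O = _")
proof (cases "even (n - c)")
  case True
  then obtain p where p: "n = c + 2 * p"
    using assms by (metis evenE le_add_diff_inverse)
  \<comment> \<open>Index sets of a given size \<open>c\<close> meet only the sum of matching
    parity, and there at the single index \<open>p\<close>.\<close>
  have "?E = (\<Sum>i = t + 1..n div 2. if i = p then nmult ((i - 1) choose t) b else 0)"
    by (intro sum.cong) (auto simp: p)
  also have "\<dots> = (if weight t (n - c) then b else 0)"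
  proof (cases "t + 1 \<le> p")
    case True
    then have "(2 * p - 1) div 2 = p - 1" by linarith
    with True show ?thesis by (simp add: p nmult_boolean weight_def)
  next
    case False
    \<comment> \<open>Here \<open>p\<close> lies below the summation range, and the weight vanishes
      as well because its binomial does.\<close>
    then have "(2 * p - 1) div 2 < t" using assms by linarith
    with False show ?thesis by (simp add: p weight_def binomial_eq_0)
  qed
  moreover have "c \<noteq> n + 1 - 2 * k" if "k \<in> {t + 1..(n + 1) div 2}" for k
    using that unfolding p by auto presburger
  then have "?O = 0" by (intro sum.neutral) auto
  ultimately show ?thesis by simp
next
  case False
  then obtain p where p: "n = c + 2 * p + 1"
    using assms by (metis oddE le_add_diff_inverse add.assoc)
  have "?O = (\<Sum>k = t + 1..(n + 1) div 2. if k = p + 1 then nmult ((2 * k - 1) choose (2 * t)) b else 0)"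
    by (intro sum.cong) (auto simp: p)
  also have "\<dots> = (if weight t (n - c) then b else 0)"
    using odd_binomial_double_Suc[of p t]
    by (cases "t \<le> p") (auto simp: p nmult_boolean weight_def binomial_eq_0)
  moreover have "c \<noteq> n - 2 * i" if "i \<in> {t + 1..n div 2}" for i
    using that unfolding p by auto presburger
  then have "?E = 0" by (intro sum.neutral) auto
  ultimately show ?thesis by simp
qed

text \<open>Exchange the summations so that \<open>I\<close> is outermost; the coefficients
  collected at each \<open>I\<close> then amount to its weight.\<close>

lemma oddsupp_formula_eq_wsum:
  fixes \<phi> :: "'a set \<Rightarrow> 'b"
  assumes "length xs = n" "t \<ge> 1"
  shows "oddsupp_formula n t \<phi> xs = wsum (weight t) \<phi> xs"
proof -
  have swap: "(\<Sum>i\<in>R. \<Sum>I | I \<subseteq> {..<n} \<and> card I = d i. h i I) =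
      (\<Sum>I\<in>Pow {..<n}. \<Sum>i\<in>R. if card I = d i then h i I else 0)"
    for R :: "nat set" and d and h :: "nat \<Rightarrow> nat set \<Rightarrow> 'b"
  proof -
    have "{I. I \<subseteq> {..<n} \<and> card I = d i} = {I \<in> Pow {..<n}. card I = d i}" for i
      by auto
    then show ?thesis
      by (simp only: sum.inter_filter finite_Pow_iff finite_lessThan sum.swap[of _ "Pow {..<n}" R])
  qed
  show ?thesis
    unfolding oddsupp_formula_def swap sum.distrib[symmetric] wsum_def assms(1)
  proof (intro sum.cong refl weight_coefficients assms)
    fix I assume "I \<in> Pow {..<n}"
    then show "card I \<le> n" using card_mono[of "{..<n}" I] by auto
  qed
qed

end

section \<open>Equivalence and uniqueness of \<open>\<phi>\<close>\<close>

theorem theorem4p2: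
  fixes z :: "'a::finite"
    and f :: "'a list \<Rightarrow> 'b::{ab_group_add, finite}"
    and n t :: nat
  assumes boolean: "\<And>b :: 'b. b + b = 0"
    and "n \<ge> 1" and "t \<ge> 1"
    and "int n - int CARD('a) = 2 * int t"
  shows "(determined_by_oddsupp n f \<longleftrightarrow> (\<exists>\<phi>. represents z n t f \<phi>)) \<and>
    (\<forall>\<phi> \<phi>'. represents z n t f \<phi> \<longrightarrow> represents z n t f \<phi>' \<longrightarrow> \<phi> = \<phi>')"
proof -
  have n: "n = CARD('a) + 2 * t"
    using assms(4) by linarith
  \<comment> \<open>For invariant \<open>\<phi>\<close> the formula collapses to
    \<open>\<phi> (oddsupp xs)\<close>, so both claims reduce to factoring \<open>f\<close> through
    \<open>oddsupp\<close> by an invariant map.\<close>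
  have represents_iff: "represents z n t f \<phi> \<longleftrightarrow>
      (\<forall>S. \<phi> S = \<phi> (sym_diff S {z})) \<and> (\<forall>xs. length xs = n \<longrightarrow> f xs = \<phi> (oddsupp xs))" for \<phi>
  proof -
    have "oddsupp_formula n t \<phi> xs = \<phi> (oddsupp xs)"
      if "\<forall>S. \<phi> S = \<phi> (sym_diff S {z})" "length xs = n" for xs
      using that n oddsupp_formula_eq_wsum[OF boolean _ \<open>t \<ge> 1\<close>]
        wsum_weight[OF boolean, of \<phi> z] by metis
    then show ?thesis
      unfolding represents_def by metis
  qed
  have "\<exists>\<phi>. represents z n t f \<phi>" if det: "determined_by_oddsupp n f"
  proof -
    obtain \<psi> where \<psi>: "\<And>xs. length xs = n \<Longrightarrow> f xs = \<psi> (oddsupp xs)"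
      using det unfolding determined_by_oddsupp_def by blast
    \<comment> \<open>Odd supports of \<open>n\<close>-tuples have the parity of \<open>n\<close>,
      so \<open>\<psi>\<close> is kept on sets of that parity; toggling \<open>z\<close> switches
      parity and carries its values to the others.\<close>
    define \<phi> where "\<phi> S = (if even (card S) = even n then \<psi> S else \<psi> (sym_diff S {z}))" for S
    have "sym_diff (sym_diff S {z}) {z} = S" for S
      by blast
    then have "\<phi> S = \<phi> (sym_diff S {z})" for S
      unfolding \<phi>_def even_card_sym_diff_singleton[OF finite] by auto
    moreover have "f xs = \<phi> (oddsupp xs)" if "length xs = n" for xs
      using that by (simp add: \<phi>_def \<psi> even_card_oddsupp)
    ultimately show ?thesis
      unfolding represents_iff by blast
  qed
  moreover have "determined_by_oddsupp n f" if "represents z n t f \<phi>" for \<phi>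
    using that unfolding represents_iff determined_by_oddsupp_def by blast
  moreover have "\<phi> = \<phi>'" if rep: "represents z n t f \<phi>" "represents z n t f \<phi>'" for \<phi> \<phi>'
  proof
    \<comment> \<open>Sets with the parity of \<open>n\<close> are odd supports of
      \<open>n\<close>-tuples, since \<open>CARD('a) \<le> n\<close>, so \<open>f\<close> fixes the
      values there; invariance fixes the remaining ones.\<close>
    have eq: "\<phi> S = \<phi>' S" if "even (card S) \<longleftrightarrow> even n" for S
    proof -
      have "card S \<le> n"
        using card_mono[of UNIV S] n by simp
      then obtain xs where "length xs = n" "oddsupp xs = S"
        using obtain_list_oddsupp \<open>even (card S) \<longleftrightarrow> even n\<close> by metis
      with rep show ?thesis
        unfolding represents_iff by metis
    qed
    fix S
    show "\<phi> S = \<phi>' S"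
    proof (cases "even (card S) \<longleftrightarrow> even n")
      case False
      then have "\<phi> (sym_diff S {z}) = \<phi>' (sym_diff S {z})"
        by (intro eq) (auto simp: even_card_sym_diff_singleton)
      with rep show ?thesis
        unfolding represents_iff by metis
    qed (rule eq)
  qed
  ultimately show ?thesis by blast
qed

end
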